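(* Let $G=(V,E)$ be a graph, let $k$ be a positive integer, let $\hat{x}\in\{0,1\}^{|V|}$ be a given defender configuration, and let $A\subseteq V$ be an attack scenario (a set of $k$ distinct vertices). Let $S\subseteq A$ and $S'\subseteq A$ be Hall violators for $\hat{x}$ such that $S\subset S'$. If $|S'\setminus S|\ge |N[S']\setminus N[S]|$, then the Benders cut defined by $S'$, namely $\sum_{i\in N[S']}x_i\ge |S'|$, is at least as strong as the Benders cut defined by $S$, namely $\sum_{i\in N[S]}x_i\ge |S|$.
   Context: $G=(V,E)$ is a (finite) undirected graph whose edges connect pairs of distinct vertices. For $v\in V$, $N[v]$ is the closed neighborhood of $v$, i.e. $v$ together with all vertices adjacent to $v$; for $S\subseteq V$, $N[S]=\bigcup_{v\in S}N[v]$. A defender configuration is a vector $\hat{x}\in\{0,1\}^{|V|}$, where $\hat{x}_i=1$ means that vertex $i$ is a defender. A set $S\subseteq A$ is a Hall violator for $\hat{x}$ if $|\{i\in N[S]:\hat{x}_i=1\}|<|S|$. The Benders feasibility cut defined by a Hall violator $S\subseteq A$ is obtained from the inequality $\sum_{j\in A}\hat\alpha_j+\sum_{i\in N[A]}\hat\beta_i x_i\le 0$ with $\hat\alpha_j=1$ for $j\in S$, $\hat\alpha_j=0$ for $j\in A\setminus S$, $\hat\beta_i=-1$ for $i\in N[S]$, $\hat\beta_i=0$ for $i\in N[A]\setminus N[S]$; that is, it is the inequality $\sum_{i\in N[S]}x_i\ge |S|$ in the variables $x\in\{0,1\}^{|V|}$. A cut $C'$ is at least as strong as a cut $C$ if every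 $x\in\{0,1\}^{|V|}$ satisfying $C'$ also satisfies $C$. *)

theory Defs
  imports Complex_Main "HOL-Library.FuncSet" "Graph_Theory.Digraph"
begin

text \<open>Finite undirected graphs are modelled by the locale \<^locale>\<open>graph\<close>: finite, loop-free
  symmetric digraphs without parallel arcs.\<close>

definition closed_nbhd :: "('a, 'b) pre_digraph \<Rightarrow> 'a \<Rightarrow> 'a set" where
  "closed_nbhd G v = insert v {u. v \<rightarrow>\<^bsub>G\<^esub> u}"

definition closed_nbhd_set :: "('a, 'b) pre_digraph \<Rightarrow> 'a set \<Rightarrow> 'a set" where
  "closed_nbhd_set G S = (\<Union>v\<in>S. closed_nbhd G v)"

text \<open>0/1-vectors are indexed by the vertices themselves and are extensional, so that each vector
  is represented by exactly one function.\<close>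

definition configurations :: "('a, 'b) pre_digraph \<Rightarrow> ('a \<Rightarrow> real) set" where
  "configurations G = (verts G \<rightarrow>\<^sub>E {0, 1})"

definition attack_scenario :: "('a, 'b) pre_digraph \<Rightarrow> nat \<Rightarrow> 'a set \<Rightarrow> bool" where
  "attack_scenario G k A \<longleftrightarrow> A \<subseteq> verts G \<and> card A = k"

definition hall_violator ::
    "('a, 'b) pre_digraph \<Rightarrow> 'a set \<Rightarrow> ('a \<Rightarrow> real) \<Rightarrow> 'a set \<Rightarrow> bool" where
  "hall_violator G A x S \<longleftrightarrow>
     S \<subseteq> A \<and> card {i \<in> closed_nbhd_set G S. x i = 1} < card S"

text \<open>A cut is represented by the predicate on vectors expressing its inequality.\<close>

definition benders_ineq ::
    "('a, 'b) pre_digraph \<Rightarrow> 'a set \<Rightarrow> ('a \<Rightarrow> real) \<Rightarrow> ('a \<Rightarrow> real) \<Rightarrow> ('a \<Rightarrow> real) \<Rightarrow> bool" where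
  "benders_ineq G A \<alpha> \<beta> x \<longleftrightarrow> (\<Sum>j\<in>A. \<alpha> j) + (\<Sum>i\<in>closed_nbhd_set G A. \<beta> i * x i) \<le> 0"

definition benders_cut :: "('a, 'b) pre_digraph \<Rightarrow> 'a set \<Rightarrow> ('a \<Rightarrow> real) \<Rightarrow> bool" where
  "benders_cut G S x \<longleftrightarrow> (\<Sum>i\<in>closed_nbhd_set G S. x i) \<ge> real (card S)"

definition at_least_as_strong ::
    "('a, 'b) pre_digraph \<Rightarrow> (('a \<Rightarrow> real) \<Rightarrow> bool) \<Rightarrow> (('a \<Rightarrow> real) \<Rightarrow> bool) \<Rightarrow> bool" where
  "at_least_as_strong G C' C \<longleftrightarrow> (\<forall>x\<in>configurations G. C' x \<longrightarrow> C x)"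

text \<open>The cut of \<open>S\<close> is the Benders inequality whose dual values are the 0/1 indicator of
  \<open>S\<close> and the negated 0/1 indicator of \<open>N[S]\<close>.\<close>

lemma benders_ineq_iff_benders_cut:
  assumes "graph G" "A \<subseteq> verts G" "S \<subseteq> A"
  shows "benders_ineq G A (\<lambda>j. if j \<in> S then 1 else 0)
           (\<lambda>i. if i \<in> closed_nbhd_set G S then - 1 else 0) x \<longleftrightarrow> benders_cut G S x"
proof -
  interpret graph G by fact
  let ?N = "closed_nbhd_set G"
  have finA: "finite A"
    using assms(2) finite_verts by (rule finite_subset)
  have "?N A \<subseteq> verts G"
    using assms(2) adj_in_verts by (auto simp: closed_nbhd_set_def closed_nbhd_def)
  then have finN: "finite (?N A)"
    using finite_verts by (rule finite_subset)
  have sub: "?N S \<subseteq> ?N A"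
    using assms(3) by (auto simp: closed_nbhd_set_def)
  have 1: "(\<Sum>j\<in>A. if j \<in> S then 1 else 0 :: real) = real (card S)"
    using finA assms(3) by (simp add: sum.If_cases Int_absorb1)
  have "(\<Sum>i\<in>?N A. (if i \<in> ?N S then - 1 else 0) * x i) = (\<Sum>i\<in>?N S. - 1 * x i)"
    using finN sub by (intro sum.mono_neutral_cong_right) auto
  then have 2: "(\<Sum>i\<in>?N A. (if i \<in> ?N S then - 1 else 0) * x i) = - (\<Sum>i\<in>?N S. x i)"
    by (simp add: sum_negf)
  show ?thesis
    unfolding benders_ineq_def benders_cut_def 1 2 by linarith
qed

end

theory Submission
  imports Defs
begin

text \<open>Enlarging \<open>S\<close> to \<open>S'\<close> raises the right-hand side of the cut by
  \<open>|S' - S|\<close>. The left-hand side gains only the terms over \<open>N[S'] - N[S]\<close>, each of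
  which is at most 1 at a 0/1-vector, so it grows by at most \<open>|N[S'] - N[S]|\<close>. If the first
  amount is at least the second, then a vector satisfying the larger cut has enough mass on
  \<open>N[S]\<close> alone to satisfy the smaller one.\<close>

lemma closed_nbhd_set_mono: "S \<subseteq> S' \<Longrightarrow> closed_nbhd_set G S \<subseteq> closed_nbhd_set G S'"
  by (auto simp: closed_nbhd_set_def)

lemma closed_nbhd_set_subset_verts:
  assumes "graph G" "S \<subseteq> verts G"
  shows "closed_nbhd_set G S \<subseteq> verts G"
proof -
  interpret graph G by fact
  show ?thesis
    using assms(2) adj_in_verts by (auto simp: closed_nbhd_set_def closed_nbhd_def)
qed

lemma sum_configuration_le_card:
  assumes "x \<in> configurations G" "B \<subseteq> verts G"
  shows "sum x B \<le> real (card B)"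
proof -
  have "x i \<le> 1" if "i \<in> B" for i
  proof -
    have "x i \<in> {0, 1}"
      using assms that by (auto simp: configurations_def dest: PiE_mem)
    then show ?thesis by auto
  qed
  then show ?thesis
    using sum_bounded_above[of B x 1] by simp
qed

theorem proposition1:
  fixes G :: "('a, 'b) pre_digraph"
    and k :: nat
    and xhat :: "'a \<Rightarrow> real"
    and A S S' :: "'a set"
  assumes "graph G"
    and "k \<ge> 1"
    and "xhat \<in> configurations G"
    and "attack_scenario G k A"
    and "hall_violator G A xhat S"
    and "hall_violator G A xhat S'"
    and "S \<subset> S'"
    and "card (S' - S) \<ge> card (closed_nbhd_set G S' - closed_nbhd_set G S)"
  shows "at_least_as_strong G (benders_cut G S') (benders_cut G S)"
proof -
  interpret graph G by fact
  let ?N = "closed_nbhd_set G"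
  have S': "S' \<subseteq> verts G"
    using assms(4,6) by (auto simp: attack_scenario_def hall_violator_def)
  then have finS': "finite S'" and N': "?N S' \<subseteq> verts G"
    using finite_verts closed_nbhd_set_subset_verts[OF assms(1)] by (auto intro: finite_subset)
  then have finN': "finite (?N S')"
    using finite_verts finite_subset by blast
  have "S \<subseteq> S'" using assms(7) by blast
  then have card_eq: "card S' = card S + card (S' - S)"
    using finS' by (metis card_Diff_subset card_mono finite_subset le_add_diff_inverse)
  have "benders_cut G S x" if x: "x \<in> configurations G" and cut: "benders_cut G S' x" for x
  proof -
    have "real (card S) + real (card (S' - S)) \<le> sum x (?N S')"
      using cut card_eq by (simp add: benders_cut_def)
    also have "\<dots> = sum x (?N S' - ?N S) + sum x (?N S)"
      using finN' \<open>S \<subseteq> S'\<close> by (intro sum.subset_diff closed_nbhd_set_mono)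
    also have "\<dots> \<le> real (card (?N S' - ?N S)) + sum x (?N S)"
      using sum_configuration_le_card[OF x, of "?N S' - ?N S"] N' by auto
    also have "\<dots> \<le> real (card (S' - S)) + sum x (?N S)"
      using assms(8) by simp
    finally show ?thesis by (simp add: benders_cut_def)
  qed
  then show ?thesis by (simp add: at_least_as_strong_def)
qed

end
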